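(* Let $\Omega$ be any proper subdomain of $\mathbb{C}$ and let $Y$ be a Hurwitz non-Lipschitz subdomain of the unit disk $\mathbb{D}$. Then $$\eta_\Omega^Y(w)=\eta_\Omega(w)\quad\text{for every } w\in\Omega.$$
   Context: A domain is a nonempty connected open subset of $\mathbb{C}$; $\mathbb{D}$ is the open unit disk. For a proper subdomain $\Omega\subsetneq\mathbb{C}$ and $w\in\Omega$, let $\mathcal{H}(w,\Omega)$ be the family of holomorphic functions $h:\mathbb{D}\to\Omega$ with $h(0)=w$, $h(t)\neq w$ for all $t\in\mathbb{D}\setminus\{0\}$, and $h'(0)>0$. The Hurwitz density of $\Omega$ is $\eta_\Omega(w)=2/r_\Omega(w)$, where $r_\Omega(w)=\max\{h'(0):h\in\mathcal{H}(w,\Omega)\}$. For a proper subdomain $Y\subsetneq\mathbb{C}$ and any domain $\Omega\subset\mathbb{C}$, the generalized Hurwitz density of $\Omega$ with basepoint domain $Y$ is $\eta_\Omega^Y(w)=\inf \eta_Y(s)/|h'(s)|$, the infimum being over all $s\in Y$ and all holomorphic $h:Y\to\Omega$ with $h(s)=w$, $h(t)\ne w$ for all $t\in Y\setminus\{s\}$, and $h'(s)\neq0$; it may equal $+\infty$ (infimum over the empty set). For a subdomain $V$ of a proper subdomain $X\subsetneq\mathbb{C}$, the infinitesimal contraction constant is $l_\eta(V,X)=\sup_{w\in V}\eta_X(w)/\eta_V(w)$ (always $\le 1$). $V$ is a Hurwitz Lipschitz subdomain of $X$ if $l_\eta(V,X)<1$, and a Hurwitz non-Lipschitz subdomain of $X$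 otherwise, i.e. if $l_\eta(V,X)=1$. *)

theory Defs
  imports "HOL-Complex_Analysis.Complex_Analysis"
begin

definition complex_domain :: "complex set \<Rightarrow> bool" where
  "complex_domain D \<longleftrightarrow> open D \<and> connected D \<and> D \<noteq> {}"

definition hurwitz_family :: "complex \<Rightarrow> complex set \<Rightarrow> (complex \<Rightarrow> complex) set" where
  "hurwitz_family w \<Omega> =
     {h. h holomorphic_on ball 0 1 \<and> h ` ball 0 1 \<subseteq> \<Omega> \<and> h 0 = w \<and>
         (\<forall>t \<in> ball 0 1 - {0}. h t \<noteq> w) \<and>
         deriv h 0 \<in> \<real> \<and> Re (deriv h 0) > 0}"

text \<open>
  The radius is a maximum over the family, not merely a supremum. \<open>Greatest\<close> has its intended
  meaning only when the maximum is attained, which is the case for a point \<open>w\<close> of a proper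
  subdomain \<open>\<Omega>\<close> of the plane.
\<close>

definition hurwitz_radius :: "complex set \<Rightarrow> complex \<Rightarrow> real" where
  "hurwitz_radius \<Omega> w = (GREATEST r. r \<in> (\<lambda>h. Re (deriv h 0)) ` hurwitz_family w \<Omega>)"

definition hurwitz_density :: "complex set \<Rightarrow> complex \<Rightarrow> real" where
  "hurwitz_density \<Omega> w = 2 / hurwitz_radius \<Omega> w"

text \<open>
  Extended real values, so that the infimum over the empty set is \<open>\<infinity>\<close>.
\<close>

definition generalized_hurwitz_density :: "complex set \<Rightarrow> complex set \<Rightarrow> complex \<Rightarrow> ereal" where
  "generalized_hurwitz_density Y \<Omega> w =
     Inf {ereal (hurwitz_density Y s / norm (deriv h s)) | s h.
            s \<in> Y \<and> h holomorphic_on Y \<and> h ` Y \<subseteq> \<Omega> \<and> h s = w \<and>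
            (\<forall>t \<in> Y - {s}. h t \<noteq> w) \<and> deriv h s \<noteq> 0}"

definition hurwitz_contraction :: "complex set \<Rightarrow> complex set \<Rightarrow> ereal" where
  "hurwitz_contraction V X = (SUP w \<in> V. ereal (hurwitz_density X w / hurwitz_density V w))"

definition hurwitz_non_lipschitz :: "complex set \<Rightarrow> complex set \<Rightarrow> bool" where
  "hurwitz_non_lipschitz V X \<longleftrightarrow>
     complex_domain X \<and> X \<noteq> UNIV \<and> complex_domain V \<and> V \<subseteq> X \<and> hurwitz_contraction V X = 1"

end

theory Submission
  imports Defs
begin

text \<open>
  Composing a competitor \<open>h : Y \<rightarrow> \<Omega>\<close> with an extremal map of \<open>Y\<close> at \<open>s\<close> gives a member of the
  Hurwitz family of \<open>\<Omega>\<close>, whence \<open>\<eta>\<^sub>\<Omega> \<le> \<eta>\<^sub>\<Omega>\<^sup>Y\<close>. Conversely, an extremal map of \<open>\<Omega>\<close> at \<open>w\<close>, precomposed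
  with a disk automorphism sending \<open>s\<close> to \<open>0\<close> and restricted to \<open>Y\<close>, gives
  \<open>\<eta>\<^sub>\<Omega>\<^sup>Y(w) \<le> \<eta>\<^sub>\<Omega>(w) \<eta>\<^sub>Y(s) / \<eta>\<^sub>\<D>(s)\<close>, and the quotient tends to \<open>1\<close> along a suitable
  sequence of points \<open>s\<close>.

  Extremal maps exist by a normal families argument. After an affine change of variable the maps
  have \<open>0\<close> as their only zero and omit \<open>1\<close>. Such a map cannot exceed \<open>1\<close> in modulus on a whole
  circle around \<open>0\<close>, as its image would then contain the unit disk. So after a rotation it is bounded
  at a fixed point of the punctured disk, where it omits \<open>0\<close> and \<open>1\<close>, and the Schottky-type bound
  for such maps applies on circles; the maximum principle extends it to disks.
\<close>

section \<open>Local bounds for maps with a single zero that omit 1\<close>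

lemma frontier_holomorphic_image_ball:
  assumes "f holomorphic_on ball 0 1" "\<not> f constant_on ball 0 1" "0 < r" "r < 1"
  shows "frontier (f ` ball 0 r) \<subseteq> f ` sphere 0 r"
proof -
  \<comment> \<open>By openness the frontier is the closure minus the image itself; compactness of
    the image of \<open>cball 0 r\<close> keeps the closure inside that image.\<close>
  have "open (f ` ball 0 r)"
    by (rule open_mapping_thm [OF assms(1)]) (use assms in auto)
  then have "frontier (f ` ball 0 r) = closure (f ` ball 0 r) - f ` ball 0 r"
    by (simp add: frontier_def interior_open)
  moreover have "continuous_on (cball 0 r) f"
    using assms by (intro holomorphic_on_imp_continuous_on holomorphic_on_subset [OF assms(1)]) auto
  then have "closed (f ` cball 0 r)"
    by (simp add: compact_continuous_image compact_imp_closed)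
  then have "closure (f ` ball 0 r) \<subseteq> f ` cball 0 r"
    by (intro closure_minimal image_mono) auto
  moreover have "cball 0 r - ball 0 r \<subseteq> sphere (0::complex) r"
    by auto
  ultimately show ?thesis by blast
qed

text \<open>Were \<open>f\<close> larger than 1 in modulus on the whole circle, the frontier of the
  image of \<open>ball 0 r\<close> would miss the closed unit disk. That disk is connected and meets
  the image at 0, so it would lie inside the image and contain no omitted value.\<close>

lemma omits_one_small_on_sphere:
  assumes "f holomorphic_on ball 0 1" "f 0 = 0" "\<And>z. z \<in> ball 0 1 \<Longrightarrow> f z \<noteq> 1"
    and "0 < r" "r < 1"
  obtains z where "norm z = r" "norm (f z) \<le> 1"
proof (rule ccontr)
  assume "\<not> thesis"
  then have big: "norm (f z) > 1" if "norm z = r" for z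
    using that \<open>\<And>z. cmod z = r \<Longrightarrow> cmod (f z) \<le> 1 \<Longrightarrow> thesis\<close> by force
  have nonconst: "\<not> f constant_on ball 0 1"
  proof
    assume "f constant_on ball 0 1"
    then obtain c where c: "\<And>z. z \<in> ball 0 1 \<Longrightarrow> f z = c"
      by (auto simp: constant_on_def)
    have "f (of_real r) = f 0"
      using c[of 0] c[of "of_real r"] assms by simp
    then show False
      using big[of "of_real r"] assms by simp
  qed
  have "cball 0 1 \<inter> frontier (f ` ball 0 r) \<noteq> {}"
  proof (rule connected_Int_frontier)
    show "cball 0 1 \<inter> f ` ball 0 r \<noteq> {}"
    proof (rule ex_in_conv[THEN iffD1], rule exI)
      have "0 \<in> f ` ball 0 r"
        by (rule image_eqI[of _ _ 0]) (use assms in auto)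
      then show "0 \<in> cball 0 1 \<inter> f ` ball 0 r" by simp
    qed
    have "1 \<in> cball 0 1 - f ` ball 0 r"
      using assms by force
    then show "cball 0 1 - f ` ball 0 r \<noteq> {}" by blast
  qed simp
  then show False
    using frontier_holomorphic_image_ball[OF assms(1) nonconst \<open>0 < r\<close> \<open>r < 1\<close>] big by force
qed

text \<open>A single \<open>B\<close> serves all \<open>f\<close>, which is what normality requires.
  The values 0 and 1 are both omitted only on the punctured disk, hence the detour through a
  circle.\<close>

lemma simple_zero_omits_one_locally_bounded:
  assumes "0 < r" "r < 1"
  obtains B where
    "\<And>f z. \<lbrakk>f holomorphic_on ball 0 1; f 0 = 0; \<forall>t \<in> ball 0 1 - {0}. f t \<noteq> 0;
        \<forall>t \<in> ball 0 1. f t \<noteq> 1; norm z \<le> r\<rbrakk> \<Longrightarrow> norm (f z) \<le> B"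
proof -
  define X where "X = {f. f holomorphic_on ball 0 1 - {0} \<and> (\<forall>z \<in> ball 0 1 - {0}. f z \<noteq> 0 \<and> f z \<noteq> (1::complex))}"
  \<comment> \<open>\<open>GPicard3\<close> needs a bound at one point common to all maps;
    \<open>1/2\<close> is an arbitrary choice of it.\<close>
  define Z where "Z = {f \<in> X. norm (f (1/2)) \<le> 1}"
  obtain B where B: "\<And>f z. f \<in> Z \<Longrightarrow> z \<in> sphere 0 r \<Longrightarrow> norm (f z) \<le> B"
  proof (rule GPicard3 [of "ball 0 1 - {0}" "1/2" Z X "sphere 0 r"])
    show "connected (ball 0 1 - {0::complex})"
      by (simp add: connected_open_delete)
  qed (use assms in \<open>auto simp: X_def Z_def\<close>)
  show thesis
  proof
    fix f :: "complex \<Rightarrow> complex" and z :: complex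
    assume f: "f holomorphic_on ball 0 1" "f 0 = 0" "\<forall>t \<in> ball 0 1 - {0}. f t \<noteq> 0"
        "\<forall>t \<in> ball 0 1. f t \<noteq> 1" and z: "norm z \<le> r"
    obtain c where c: "norm c = 1/2" "norm (f c) \<le> 1"
      using omits_one_small_on_sphere[of f "1/2"] f by auto
    \<comment> \<open>Since \<open>norm c = 1/2\<close>, the factor \<open>2 * c\<close> is a
      rotation, and it moves the good point \<open>c\<close> to \<open>1/2\<close>:
      \<open>g (1/2) = f c\<close>.\<close>
    define g where "g = (\<lambda>z. f (2 * c * z))"
    have "f \<circ> (\<lambda>z. 2 * c * z) holomorphic_on ball 0 1"
      by (rule holomorphic_on_compose_gen[OF _ f(1)])
         (auto intro!: holomorphic_intros simp: norm_mult c)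
    then have "g holomorphic_on ball 0 1"
      by (simp add: g_def o_def)
    moreover have "c \<noteq> 0" using c by auto
    moreover have "2 * c * t \<in> ball 0 1 - {0}" if "t \<in> ball 0 1 - {0}" for t
    proof -
      have "norm (2 * c * t) = norm t" using c(1) by (simp add: norm_mult)
      then show ?thesis using that by (metis Diff_iff insert_iff mem_ball_0 norm_eq_zero singletonD)
    qed
    ultimately have "g \<in> Z"
      using f c(2) unfolding Z_def X_def g_def
      by (auto elim!: holomorphic_on_subset simp del: mem_ball)
    have sph: "norm (f u) \<le> B" if "norm u = r" for u
    proof -
      have "norm (g (u / (2 * c))) \<le> B"
        by (rule B[OF \<open>g \<in> Z\<close>]) (simp add: norm_divide norm_mult c(1) that)
      then show ?thesis using \<open>c \<noteq> 0\<close> by (simp add: g_def)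
    qed
    show "norm (f z) \<le> B"
    proof (rule maximum_modulus_frontier[of f "cball 0 r"])
      show "f holomorphic_on interior (cball 0 r)"
        by (rule holomorphic_on_subset[OF f(1)]) (use assms in auto)
      show "continuous_on (closure (cball 0 r)) f"
        by (intro holomorphic_on_imp_continuous_on holomorphic_on_subset[OF f(1)])
           (use assms in auto)
    qed (use z assms sph in \<open>auto simp: frontier_cball\<close>)
  qed
qed

text \<open>For a point \<open>a\<close> outside \<Omega>, the map
  \<open>(h z - w) / (a - w)\<close> vanishes only at 0 and omits 1, so the preceding bound applies
  with a constant independent of \<open>h\<close>.\<close>

lemma hurwitz_family_locally_bounded:
  assumes "w \<in> \<Omega>" "\<Omega> \<noteq> UNIV" "compact K" "K \<subseteq> ball 0 1"
  shows "\<exists>B. \<forall>h \<in> hurwitz_family w \<Omega>. \<forall>z \<in> K. norm (h z) \<le> B"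
proof -
  obtain a where a: "a \<notin> \<Omega>" using assms by auto
  then have aw: "a \<noteq> w" using assms by auto
  obtain r where r: "0 < r" "r < 1" "K \<subseteq> cball 0 r"
  proof (cases "K = {}")
    case True
    then show thesis using that[of "1/2"] by auto
  next
    case False
    then obtain x where x: "x \<in> K" "\<And>y. y \<in> K \<Longrightarrow> norm y \<le> norm x"
      using continuous_attains_sup[of K norm] assms continuous_on_norm_id by blast
    then have "norm x < 1" using assms by auto
    \<comment> \<open>The midpoint between the largest modulus in \<open>K\<close> and 1 is a radius
      below 1 that stays positive even for \<open>K = {0}\<close>.\<close>
    show thesis
    proof (rule that[of "(norm x + 1) / 2"])
      show "K \<subseteq> cball 0 ((norm x + 1) / 2)"
        using x(2) \<open>norm x < 1\<close> by force
      show "0 < (norm x + 1) / 2"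
        by (intro divide_pos_pos add_nonneg_pos) auto
    qed (use \<open>norm x < 1\<close> in simp)
  qed
  obtain B where B: "\<And>f z. \<lbrakk>f holomorphic_on ball 0 1; f 0 = 0; \<forall>t \<in> ball 0 1 - {0}. f t \<noteq> 0;
        \<forall>t \<in> ball 0 1. f t \<noteq> 1; norm z \<le> r\<rbrakk> \<Longrightarrow> norm (f z) \<le> B"
    using simple_zero_omits_one_locally_bounded[OF r(1,2)] by metis
  have "norm (h z) \<le> B * norm (a - w) + norm w" if h: "h \<in> hurwitz_family w \<Omega>" and z: "z \<in> K" for h z
  proof -
    have "norm ((\<lambda>z. (h z - w) / (a - w)) z) \<le> B"
    proof (rule B[of "\<lambda>z. (h z - w) / (a - w)"])
      show "(\<lambda>z. (h z - w) / (a - w)) holomorphic_on ball 0 1"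
        using h aw by (auto simp: hurwitz_family_def intro!: holomorphic_intros)
      show "\<forall>t \<in> ball 0 1. (h t - w) / (a - w) \<noteq> 1"
        using h a aw by (auto simp: hurwitz_family_def image_subset_iff)
    qed (use h aw r z in \<open>auto simp: hurwitz_family_def\<close>)
    then have "norm (h z - w) \<le> B * norm (a - w)"
      using aw by (simp add: norm_divide field_simps)
    then show ?thesis
      using norm_triangle_ineq[of "h z - w" w] by simp
  qed
  then show ?thesis by blast
qed

section \<open>Existence of extremal maps\<close>

lemma hurwitz_family_nonempty:
  assumes "open \<Omega>" "w \<in> \<Omega>"
  shows "hurwitz_family w \<Omega> \<noteq> {}"
proof -
  obtain e where e: "e > 0" "ball w e \<subseteq> \<Omega>"
    using assms by (meson openE)
  have "((\<lambda>z. w + of_real e * z) has_field_derivative of_real e) (at 0)"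
    by (auto intro!: derivative_eq_intros)
  then have "deriv (\<lambda>z. w + of_real e * z) 0 = of_real e"
    by (rule DERIV_imp_deriv)
  moreover have "w + of_real e * z \<in> \<Omega>" if "norm z < 1" for z
    using e that by (auto intro!: subsetD[OF e(2)] simp: dist_norm norm_mult)
  ultimately have "(\<lambda>z. w + of_real e * z) \<in> hurwitz_family w \<Omega>"
    using e by (auto simp: hurwitz_family_def intro!: holomorphic_intros)
  then show ?thesis by blast
qed

text \<open>Hurwitz's theorem passes omitted values on to a nonconstant limit; the positive
  derivative at 0 is what excludes a constant one.\<close>

lemma hurwitz_family_limit:
  fixes \<F> :: "nat \<Rightarrow> complex \<Rightarrow> complex"
  assumes \<F>: "\<And>n. \<F> n \<in> hurwitz_family w \<Omega>"
    and g: "g holomorphic_on ball 0 1"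
    and ul: "\<And>K. \<lbrakk>compact K; K \<subseteq> ball 0 1\<rbrakk> \<Longrightarrow> uniform_limit K \<F> g sequentially"
    and der: "deriv g 0 \<in> \<real>" "Re (deriv g 0) > 0"
  shows "g \<in> hurwitz_family w \<Omega>"
proof -
  have hol: "\<F> n holomorphic_on ball 0 1" and zero: "\<F> n 0 = w" 
    and nw: "t \<in> ball 0 1 - {0} \<Longrightarrow> \<F> n t \<noteq> w" and img: "t \<in> ball 0 1 \<Longrightarrow> \<F> n t \<in> \<Omega>" for n t
    using \<F>[of n] by (auto simp: hurwitz_family_def)
  have g0: "g 0 = w"
  proof -
    have "(\<lambda>n. \<F> n 0) \<longlonglongrightarrow> g 0"
      using ul[of "{0}"] by (auto intro: tendsto_uniform_limitI)
    then show ?thesis by (simp add: zero LIMSEQ_const_iff)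
  qed
  \<comment> \<open>General \<open>S\<close>, because Hurwitz's theorem is applied both on the disk
    and on the punctured disk; analytic continuation carries constancy from \<open>S\<close> to the
    disk.\<close>
  have nonconst: "\<not> g constant_on S" if S: "open S" "S \<noteq> {}" "S \<subseteq> ball 0 1" for S
  proof
    assume "g constant_on S"
    then obtain c where "\<And>z. z \<in> S \<Longrightarrow> g z = c" by (auto simp: constant_on_def)
    then have c: "g z = c" if "z \<in> ball 0 1" for z
      using analytic_continuation_open[of S "ball 0 1" g "\<lambda>_. c" z] S g that by auto
    have "(g has_field_derivative 0) (at 0)"
      by (rule has_field_derivative_transform_within_open[of "\<lambda>_. c" _ _ "ball 0 1"]) (use c in auto)
    then show False
      using der DERIV_imp_deriv by force
  qed
  have omit: "g z \<noteq> c"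
    if S: "open S" "connected S" "S \<subseteq> ball 0 1" and z: "z \<in> S"
      and c: "\<And>n t. t \<in> S \<Longrightarrow> \<F> n t \<noteq> c" for S z c
  proof -
    have "g z - c \<noteq> 0"
    proof (rule Hurwitz_no_zeros[of S "\<lambda>n z. \<F> n z - c" "\<lambda>z. g z - c"])
      show "(\<lambda>z. \<F> n z - c) holomorphic_on S" for n
        using holomorphic_on_subset[OF hol] S by (intro holomorphic_intros) auto
      show "(\<lambda>z. g z - c) holomorphic_on S"
        using holomorphic_on_subset[OF g] S by (intro holomorphic_intros) auto
      show "uniform_limit K (\<lambda>n z. \<F> n z - c) (\<lambda>z. g z - c) sequentially"
        if "compact K" "K \<subseteq> S" for K
        using ul[of K] that S by (intro uniform_limit_intros) auto
      have "\<not> g constant_on S" using nonconst S z by blast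
      then show "\<not> (\<lambda>z. g z - c) constant_on S"
        by (auto simp: constant_on_def) (metis diff_add_cancel)
    qed (use S z c in auto)
    then show ?thesis by simp
  qed
  \<comment> \<open>If \<open>g z\<close> lay outside \<Omega>, every \<open>\<F> n\<close> would
    omit this value on the disk, and then so would \<open>g\<close>.\<close>
  have "g z \<in> \<Omega>" if "z \<in> ball 0 1" for z
    using omit[of "ball 0 1" z "g z"] img that by (metis connected_ball open_ball order_refl)
  moreover have "g z \<noteq> w" if "z \<in> ball 0 1 - {0}" for z
  proof (rule omit[of "ball 0 1 - {0}"])
    show "connected (ball 0 1 - {0::complex})"
      by (simp add: connected_open_delete)
  qed (use that nw in auto)
  ultimately show ?thesis
    using g g0 der by (auto simp: hurwitz_family_def)
qed

text \<open>Cauchy's estimate makes the supremum \<open>M\<close> of the derivatives finite.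
  Montel's theorem extracts a limit from a maximising sequence, and derivatives converge along with
  the maps.\<close>

lemma hurwitz_family_attains_max:
  assumes "open \<Omega>" "w \<in> \<Omega>" "\<Omega> \<noteq> UNIV"
  obtains f where "f \<in> hurwitz_family w \<Omega>"
    "\<And>h. h \<in> hurwitz_family w \<Omega> \<Longrightarrow> Re (deriv h 0) \<le> Re (deriv f 0)"
proof -
  let ?H = "hurwitz_family w \<Omega>"
  let ?R = "(\<lambda>h. Re (deriv h 0)) ` ?H"
  have hol: "h holomorphic_on ball 0 1" if "h \<in> ?H" for h
    using that by (simp add: hurwitz_family_def)
  have ne: "?R \<noteq> {}"
    using hurwitz_family_nonempty assms by simp
  obtain B where B: "\<forall>h \<in> ?H. \<forall>z \<in> cball 0 (1/2). norm (h z) \<le> B"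
    using hurwitz_family_locally_bounded[OF assms(2,3), of "cball 0 (1/2)"]
    by (auto simp: cball_subset_ball_iff)
  have "Re (deriv h 0) \<le> B / (1/2)" if "h \<in> ?H" for h
  proof -
    have "norm ((deriv ^^ 1) h 0) \<le> fact 1 * B / (1/2) ^ 1"
    proof (rule Cauchy_inequality)
      show "h holomorphic_on ball 0 (1/2)"
        by (rule holomorphic_on_subset[OF hol[OF that]]) auto
      show "continuous_on (cball 0 (1/2)) h"
        by (intro holomorphic_on_imp_continuous_on holomorphic_on_subset[OF hol[OF that]]) auto
    qed (use B that in auto)
    then show ?thesis
      using complex_Re_le_cmod[of "deriv h 0"] by simp
  qed
  then have bdd: "bdd_above ?R"
    by (auto intro!: bdd_aboveI)
  define M where "M = Sup ?R"
  have M: "Re (deriv h 0) \<le> M" if "h \<in> ?H" for h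
    unfolding M_def using bdd that by (intro cSup_upper) auto
  have "\<exists>h \<in> ?H. Re (deriv h 0) > M - 1 / Suc n" for n
    using less_cSup_iff[OF ne bdd, of "M - 1 / Suc n"] by (auto simp flip: M_def)
  then obtain \<F> where \<F>: "\<And>n. \<F> n \<in> ?H" "\<And>n. Re (deriv (\<F> n) 0) > M - 1 / Suc n"
    by metis
  obtain g r where g: "g holomorphic_on ball 0 1" and r: "strict_mono (r :: nat \<Rightarrow> nat)"
    and ul: "\<And>K. \<lbrakk>compact K; K \<subseteq> ball 0 1\<rbrakk> \<Longrightarrow> uniform_limit K (\<F> \<circ> r) g sequentially"
    by (rule Montel[of "ball 0 1" ?H \<F>])
       (use hol hurwitz_family_locally_bounded[OF assms(2,3)] \<F>(1) in blast)+
  have lim: "(\<lambda>n. deriv (\<F> (r n)) 0) \<longlonglongrightarrow> deriv g 0"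
  proof -
    have "uniform_limit (ball 0 (1/2)) (\<F> \<circ> r) g sequentially"
      by (rule uniform_limit_on_subset[OF ul[of "cball 0 (1/2)"]]) auto
    moreover have "(\<F> \<circ> r) n holomorphic_on ball 0 (1/2)" for n
      unfolding o_def
      by (rule holomorphic_on_subset[OF hol[OF \<F>(1)]]) (simp add: ball_subset_ball_iff)
    ultimately show ?thesis
      using higher_deriv_complex_uniform_limit[where A = "ball 0 (1/2)" and f = "\<F> \<circ> r"
          and g = g and F = sequentially and z = 0 and m = 1] by simp
  qed
  have "(\<lambda>n. M - 1 / Suc n) \<longlonglongrightarrow> M"
    by real_asymp
  then have "(\<lambda>n. M - 1 / Suc (r n)) \<longlonglongrightarrow> M"
    using LIMSEQ_subseq_LIMSEQ[OF _ r] by (auto simp: o_def)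
  moreover have "(\<lambda>n. Re (deriv (\<F> (r n)) 0)) \<longlonglongrightarrow> Re (deriv g 0)"
    by (intro tendsto_intros lim)
  ultimately have Mg: "M \<le> Re (deriv g 0)"
    by (rule LIMSEQ_le) (use \<F>(2) in \<open>auto intro: less_imp_le\<close>)
  \<comment> \<open>This gives the limit a positive derivative, so that it stays in the
    family.\<close>
  moreover have "M > 0"
  proof -
    have "0 < Re (deriv (\<F> 0) 0)"
      using \<F>(1)[of 0] by (simp add: hurwitz_family_def)
    also have "\<dots> \<le> M"
      by (rule M[OF \<F>(1)])
    finally show ?thesis .
  qed
  moreover have "deriv g 0 \<in> \<real>"
    by (rule Lim_in_closed_set[OF closed_complex_Reals _ _ lim])
       (use \<F>(1) in \<open>auto simp: hurwitz_family_def\<close>)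
  moreover have "(\<F> \<circ> r) n \<in> ?H" for n
    using \<F>(1) by simp
  ultimately have "g \<in> ?H"
    using hurwitz_family_limit[OF _ g ul, of w \<Omega>] by force
  moreover have "Re (deriv h 0) \<le> Re (deriv g 0)" if "h \<in> ?H" for h
    using M[OF that] Mg by (rule order_trans)
  ultimately show thesis
    using that by blast
qed

text \<open>Attainment is what gives the \<open>GREATEST\<close> in \<open>hurwitz_radius\<close>
  its value; all later arguments use the radius only through these properties.\<close>

lemma hurwitz_radius_attained:
  assumes "open \<Omega>" "w \<in> \<Omega>" "\<Omega> \<noteq> UNIV"
  obtains f where "f \<in> hurwitz_family w \<Omega>" "deriv f 0 = of_real (hurwitz_radius \<Omega> w)"
    "0 < hurwitz_radius \<Omega> w"
    "\<And>h. h \<in> hurwitz_family w \<Omega> \<Longrightarrow> Re (deriv h 0) \<le> hurwitz_radius \<Omega> w"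
proof -
  obtain f where f: "f \<in> hurwitz_family w \<Omega>"
    "\<And>h. h \<in> hurwitz_family w \<Omega> \<Longrightarrow> Re (deriv h 0) \<le> Re (deriv f 0)"
    using hurwitz_family_attains_max[OF assms] by blast
  have "hurwitz_radius \<Omega> w = Re (deriv f 0)"
    unfolding hurwitz_radius_def by (rule Greatest_equality) (use f in auto)
  then show thesis
    using f by (intro that[of f]) (auto simp: hurwitz_family_def complex_eq_iff complex_is_Real_iff)
qed

text \<open>Rotating the variable makes the derivative positive without changing its modulus, so
  competitors with arbitrary nonzero derivative can be compared with the radius.\<close>

lemma norm_deriv_le_hurwitz_radius:
  assumes \<Omega>: "open \<Omega>" "w \<in> \<Omega>" "\<Omega> \<noteq> UNIV"
    and h: "h holomorphic_on ball 0 1" "h ` ball 0 1 \<subseteq> \<Omega>" "h 0 = w"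
      "\<And>t. t \<in> ball 0 1 - {0} \<Longrightarrow> h t \<noteq> w"
    and nz: "deriv h 0 \<noteq> 0"
  shows "norm (deriv h 0) \<le> hurwitz_radius \<Omega> w"
proof -
  \<comment> \<open>The conjugate phase: multiplying by \<open>c\<close> turns
    \<open>deriv h 0\<close> into its modulus.\<close>
  define c where "c = cnj (sgn (deriv h 0))"
  have c: "norm c = 1" "c * deriv h 0 = of_real (norm (deriv h 0))" "c \<noteq> 0"
    using nz complex_norm_square[of "deriv h 0"]
    by (auto simp: c_def sgn_div_norm norm_divide power2_eq_square scaleR_conv_of_real field_simps)
  have ball: "c * t \<in> ball 0 1 \<longleftrightarrow> t \<in> ball 0 1" for t
    using c by (simp add: norm_mult)
  have "(h has_field_derivative deriv h 0) (at (c * 0))"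
    using holomorphic_derivI[OF h(1)] by simp
  then have "((\<lambda>z. h (c * z)) has_field_derivative deriv h 0 * c) (at 0)"
    by (rule DERIV_chain2) (auto intro!: derivative_eq_intros)
  then have der: "deriv (\<lambda>z. h (c * z)) 0 = of_real (norm (deriv h 0))"
    using c(2) by (simp add: DERIV_imp_deriv mult.commute)
  have "(\<lambda>z. h (c * z)) \<in> hurwitz_family w \<Omega>"
    unfolding hurwitz_family_def mem_Collect_eq
  proof (intro conjI ballI)
    show "(\<lambda>z. h (c * z)) holomorphic_on ball 0 1"
      by (rule holomorphic_on_compose_gen[unfolded o_def, OF _ h(1)])
         (use ball in \<open>auto intro!: holomorphic_intros\<close>)
    show "(\<lambda>z. h (c * z)) ` ball 0 1 \<subseteq> \<Omega>"
      using h(2) ball by blast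
    show "h (c * t) \<noteq> w" if "t \<in> ball 0 1 - {0}" for t
      using h(4)[of "c * t"] that ball c(3) by auto
  qed (use der h nz in auto)
  then show ?thesis
    using hurwitz_radius_attained[OF \<Omega>] der by (metis Re_complex_of_real)
qed

section \<open>Disk automorphisms and the Hurwitz radius of the disk\<close>

lemma one_minus_cnj_mult_nonzero:
  assumes "norm a < 1" "norm z < 1"
  shows "1 - cnj a * z \<noteq> 0"
proof
  assume "1 - cnj a * z = 0"
  then have "norm (cnj a * z) = 1" by (metis norm_one right_minus_eq)
  then show False
    using norm_mult_less[of "cnj a" 1 z 1] assms by simp
qed

lemma DERIV_Moebius_function:
  assumes "norm a < 1" "norm z < 1"
  shows "(Moebius_function 0 a has_field_derivative
           of_real (1 - (norm a)\<^sup>2) / (1 - cnj a * z)\<^sup>2) (at z)"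
proof -
  have nz: "1 - cnj a * z \<noteq> 0"
    using one_minus_cnj_mult_nonzero[OF assms] .
  have "((\<lambda>z. (z - a) / (1 - cnj a * z)) has_field_derivative
      (1 * (1 - cnj a * z) - (z - a) * (- cnj a)) / ((1 - cnj a * z) * (1 - cnj a * z))) (at z)"
    by (rule DERIV_divide) (use nz in \<open>auto intro!: derivative_eq_intros\<close>)
  moreover have "1 * (1 - cnj a * z) - (z - a) * (- cnj a) = of_real (1 - (norm a)\<^sup>2)"
    unfolding of_real_diff of_real_1 complex_norm_square by (simp add: algebra_simps)
  ultimately show ?thesis
    by (simp only: Moebius_function_simple[abs_def] power2_eq_square[of "1 - cnj a * z"])
qed

lemma DERIV_Moebius_function_self:
  assumes "norm a < 1"
  shows "(Moebius_function 0 a has_field_derivative 1 / of_real (1 - (norm a)\<^sup>2)) (at a)"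
proof -
  have "1 - cnj a * a = of_real (1 - (norm a)\<^sup>2)"
    using complex_norm_square[of a] by (simp add: mult.commute)
  moreover have "1 - cnj a * a \<noteq> 0"
    using one_minus_cnj_mult_nonzero assms by blast
  ultimately show ?thesis
    using DERIV_Moebius_function[OF assms assms] by (simp add: power2_eq_square)
qed

lemma Moebius_function_eq_zero_iff:
  assumes "norm a < 1" "norm z < 1"
  shows "Moebius_function 0 a z = 0 \<longleftrightarrow> z = a"
  using one_minus_cnj_mult_nonzero[OF assms] by (simp add: Moebius_function_simple)

text \<open>The upper bound is the Schwarz lemma for an extremal map followed by the automorphism
  taking \<open>s\<close> to 0. The inverse automorphism, \<open>Moebius_function 0 (- s)\<close>,
  is a competitor that attains it.\<close>

lemma hurwitz_radius_unit_ball: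
  assumes "norm s < 1"
  shows "hurwitz_radius (ball 0 1) s = 1 - (norm s)\<^sup>2"
proof (rule antisym)
  have pos: "1 - (norm s)\<^sup>2 > 0"
    using assms by (simp add: power_less_one_iff)
  have ne: "ball 0 1 \<noteq> (UNIV :: complex set)"
    by (metis ball_eq_cball_iff bounded_ball not_bounded_UNIV)
  obtain f where f: "f \<in> hurwitz_family s (ball 0 1)"
      "deriv f 0 = of_real (hurwitz_radius (ball 0 1) s)" "0 < hurwitz_radius (ball 0 1) s"
    using hurwitz_radius_attained[of "ball 0 1" s] assms ne by auto
  have f': "f holomorphic_on ball 0 1" "f 0 = s" "\<And>t. norm t < 1 \<Longrightarrow> norm (f t) < 1"
    using f(1) by (auto simp: hurwitz_family_def image_subset_iff)
  let ?g = "Moebius_function 0 s \<circ> f"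
  have "?g holomorphic_on ball 0 1"
    by (rule holomorphic_on_compose_gen[OF f'(1) Moebius_function_holomorphic[OF assms]])
       (use f'(3) in auto)
  moreover have "?g 0 = 0"
    by (simp add: f' Moebius_function_eq_zero)
  moreover have "norm (?g z) < 1" if "norm z < 1" for z
    using Moebius_function_norm_lt_1 f'(3) that assms by simp
  ultimately have "norm (deriv ?g 0) \<le> 1"
    using Schwarz_Lemma[of ?g 0] by simp
  moreover have "deriv ?g 0 = 1 / of_real (1 - (norm s)\<^sup>2) * deriv f 0"
    by (rule DERIV_imp_deriv, rule DERIV_chain)
       (use DERIV_Moebius_function_self[OF assms] f'(2) holomorphic_derivI[OF f'(1)] in auto)
  ultimately have "norm (of_real (hurwitz_radius (ball 0 1) s / (1 - (norm s)\<^sup>2)) :: complex) \<le> 1"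
    using f(2) by simp
  then show "hurwitz_radius (ball 0 1) s \<le> 1 - (norm s)\<^sup>2"
    using pos f(3) by (simp only: norm_of_real) (simp add: field_simps)
  have d: "deriv (Moebius_function 0 (- s)) 0 = of_real (1 - (norm s)\<^sup>2)"
    using DERIV_imp_deriv[OF DERIV_Moebius_function[of "- s" 0]] assms by simp
  have "norm (deriv (Moebius_function 0 (- s)) 0) \<le> hurwitz_radius (ball 0 1) s"
  proof (rule norm_deriv_le_hurwitz_radius)
    show "Moebius_function 0 (- s) holomorphic_on ball 0 1"
      using Moebius_function_holomorphic assms by simp
    show "Moebius_function 0 (- s) ` ball 0 1 \<subseteq> ball 0 1"
      using Moebius_function_norm_lt_1[of "- s"] assms by auto
    show "Moebius_function 0 (- s) 0 = s"
      by (simp add: Moebius_function_simple)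
    \<comment> \<open>Applying the inverse automorphism to a supposed equality gives
      \<open>t = 0\<close>.\<close>
    show "Moebius_function 0 (- s) t \<noteq> s" if t: "t \<in> ball 0 1 - {0}" for t
    proof
      assume "Moebius_function 0 (- s) t = s"
      then have "Moebius_function 0 s s = t"
        using Moebius_function_compose[of s "- s" t] assms t by simp
      then show False using t by (simp add: Moebius_function_eq_zero)
    qed
  qed (use assms ne d pos in \<open>auto simp del: of_real_diff\<close>)
  then show "1 - (norm s)\<^sup>2 \<le> hurwitz_radius (ball 0 1) s"
    using d pos by (simp only: norm_of_real)
qed

section \<open>Comparison of the two densities\<close>

lemma hurwitz_density_le_generalized:
  assumes \<Omega>: "open \<Omega>" "w \<in> \<Omega>" "\<Omega> \<noteq> UNIV" and Y: "open Y" "Y \<noteq> UNIV"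
  shows "ereal (hurwitz_density \<Omega> w) \<le> generalized_hurwitz_density Y \<Omega> w"
  unfolding generalized_hurwitz_density_def
proof (intro Inf_greatest, clarify)
  fix s h
  assume s: "s \<in> Y" and h: "h holomorphic_on Y" "h ` Y \<subseteq> \<Omega>" "w = h s"
    "\<forall>t \<in> Y - {s}. h t \<noteq> h s" "deriv h s \<noteq> 0"
  obtain g where g: "g \<in> hurwitz_family s Y" "deriv g 0 = of_real (hurwitz_radius Y s)"
      "0 < hurwitz_radius Y s"
    using hurwitz_radius_attained[OF Y(1) s Y(2)] by metis
  have g': "g holomorphic_on ball 0 1" "g ` ball 0 1 \<subseteq> Y" "g 0 = s"
      "\<And>t. t \<in> ball 0 1 - {0} \<Longrightarrow> g t \<noteq> s"
    using g(1) by (auto simp: hurwitz_family_def)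
  have "(g has_field_derivative of_real (hurwitz_radius Y s)) (at 0)"
    using holomorphic_derivI[OF g'(1), of 0] g(2) by simp
  then have d: "deriv (h \<circ> g) 0 = deriv h s * of_real (hurwitz_radius Y s)"
    using holomorphic_derivI[OF h(1) Y(1) s] g'(3)
    by (intro DERIV_imp_deriv DERIV_chain) auto
  have "norm (deriv (h \<circ> g) 0) \<le> hurwitz_radius \<Omega> w"
  proof (rule norm_deriv_le_hurwitz_radius[OF \<Omega>])
    show "h \<circ> g holomorphic_on ball 0 1"
      by (rule holomorphic_on_compose_gen[OF g'(1) h(1) g'(2)])
    \<comment> \<open>Away from 0 the map \<open>g\<close> stays in \<open>Y\<close> and avoids
      \<open>s\<close>, the only point where \<open>h\<close> takes the value
      \<open>w\<close>.\<close>
    show "(h \<circ> g) t \<noteq> w" if "t \<in> ball 0 1 - {0}" for t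
    proof -
      have "g t \<in> Y - {s}" using g'(2) g'(4)[OF that] that by blast
      then show ?thesis using h(3,4) by simp
    qed
  qed (use d g(3) g' h in auto)
  then have "norm (deriv h s) * hurwitz_radius Y s \<le> hurwitz_radius \<Omega> w"
    using d g(3) by (simp add: norm_mult)
  moreover have "norm (deriv h s) * hurwitz_radius Y s > 0"
    using h(5) g(3) by simp
  ultimately have "2 / hurwitz_radius \<Omega> w \<le> 2 / (norm (deriv h s) * hurwitz_radius Y s)"
    by (intro divide_left_mono) (auto intro: mult_pos_pos)
  then show "ereal (hurwitz_density \<Omega> (h s)) \<le> ereal (hurwitz_density Y s / norm (deriv h s))"
    using h(3) by (simp add: hurwitz_density_def mult.commute)
qed

text \<open>The factor in front of \<open>hurwitz_density \<Omega> w\<close> is the reciprocal of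
  the quotient whose supremum over \<open>Y\<close> is the contraction constant.\<close>

lemma generalized_hurwitz_density_le:
  assumes \<Omega>: "open \<Omega>" "w \<in> \<Omega>" "\<Omega> \<noteq> UNIV" and Y: "Y \<subseteq> ball 0 1" "s \<in> Y"
  shows "generalized_hurwitz_density Y \<Omega> w \<le>
           ereal (hurwitz_density Y s / hurwitz_density (ball 0 1) s * hurwitz_density \<Omega> w)"
proof -
  have s: "norm s < 1" using Y by auto
  have pos: "1 - (norm s)\<^sup>2 > 0"
    using s by (simp add: power_less_one_iff)
  obtain f where f: "f \<in> hurwitz_family w \<Omega>" "deriv f 0 = of_real (hurwitz_radius \<Omega> w)"
      "0 < hurwitz_radius \<Omega> w"
    using hurwitz_radius_attained[OF \<Omega>] by metis
  have f': "f holomorphic_on ball 0 1" "f ` ball 0 1 \<subseteq> \<Omega>" "f 0 = w"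
      "\<And>t. t \<in> ball 0 1 - {0} \<Longrightarrow> f t \<noteq> w"
    using f(1) by (auto simp: hurwitz_family_def)
  define h where "h = f \<circ> Moebius_function 0 s"
  have img: "Moebius_function 0 s t \<in> ball 0 1" if "t \<in> Y" for t
    using Moebius_function_norm_lt_1[OF s] that Y by auto
  have d: "deriv h s = of_real (hurwitz_radius \<Omega> w / (1 - (norm s)\<^sup>2))"
  proof -
    have "(h has_field_derivative deriv f 0 * (1 / of_real (1 - (norm s)\<^sup>2))) (at s)"
      unfolding h_def
      by (rule DERIV_chain)
         (use DERIV_Moebius_function_self[OF s] holomorphic_derivI[OF f'(1), of 0]
           in \<open>auto simp: Moebius_function_eq_zero\<close>)
    then show ?thesis
      using f(2) by (simp add: DERIV_imp_deriv)
  qed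
  have "h holomorphic_on Y"
    unfolding h_def
    by (rule holomorphic_on_compose_gen[OF _ f'(1)])
       (use img holomorphic_on_subset[OF Moebius_function_holomorphic[OF s] Y(1)] in auto)
  moreover have "h ` Y \<subseteq> \<Omega>"
    using img f'(2) by (auto simp: h_def)
  moreover have "h s = w"
    by (simp add: h_def Moebius_function_eq_zero f')
  moreover have "h t \<noteq> w" if "t \<in> Y - {s}" for t
    using f'(4)[of "Moebius_function 0 s t"] img[of t] that Y(1)
      Moebius_function_eq_zero_iff[OF s, of t] by (auto simp: h_def)
  moreover have "deriv h s \<noteq> 0"
    unfolding d of_real_eq_0_iff using pos f(3) by simp
  ultimately have "generalized_hurwitz_density Y \<Omega> w \<le> ereal (hurwitz_density Y s / norm (deriv h s))"
    unfolding generalized_hurwitz_density_def using Y(2) by (intro Inf_lower) blast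
  also have "norm (deriv h s) = hurwitz_radius \<Omega> w / (1 - (norm s)\<^sup>2)"
    unfolding d norm_of_real using pos f(3) by simp
  \<comment> \<open>Here \<open>1 - (norm s)\<^sup>2\<close>, which came from the derivative of the
    automorphism at \<open>s\<close>, is recognised as the Hurwitz radius of the disk at
    \<open>s\<close>.\<close>
  also have "hurwitz_density Y s / (hurwitz_radius \<Omega> w / (1 - (norm s)\<^sup>2)) =
      hurwitz_density Y s / hurwitz_density (ball 0 1) s * hurwitz_density \<Omega> w"
    using pos f(3) hurwitz_radius_unit_ball[OF s]
    by (simp add: hurwitz_density_def[of "ball 0 1"] hurwitz_density_def[of \<Omega>])
  finally show ?thesis .
qed

theorem theorem4p3:
  fixes \<Omega> Y :: "complex set"
  assumes "complex_domain \<Omega>" and "\<Omega> \<noteq> UNIV"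
    and "hurwitz_non_lipschitz Y (ball 0 1)"
  shows "\<forall>w \<in> \<Omega>. generalized_hurwitz_density Y \<Omega> w = ereal (hurwitz_density \<Omega> w)"
proof (intro ballI antisym)
  fix w assume w: "w \<in> \<Omega>"
  have \<Omega>: "open \<Omega>" using assms(1) by (simp add: complex_domain_def)
  have Y: "open Y" "Y \<subseteq> ball 0 1" "Y \<noteq> UNIV"
    and sup: "(SUP s \<in> Y. ereal (hurwitz_density (ball 0 1) s / hurwitz_density Y s)) = 1"
    using assms(3) by (auto simp: hurwitz_non_lipschitz_def complex_domain_def hurwitz_contraction_def)
  show "ereal (hurwitz_density \<Omega> w) \<le> generalized_hurwitz_density Y \<Omega> w"
    using hurwitz_density_le_generalized[OF \<Omega> w assms(2) Y(1,3)] .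
  have pos: "hurwitz_density D z > 0" if "open D" "z \<in> D" "D \<noteq> UNIV" for D z
    using hurwitz_radius_attained[OF that] unfolding hurwitz_density_def
    by (metis divide_pos_pos zero_less_numeral)
  \<comment> \<open>The supremum 1 may fail to be attained, so a point \<open>s\<close> is chosen
    whose quotient exceeds a given \<open>c < 1\<close>; afterwards \<open>c\<close> tends to 1 from
    the left.\<close>
  have "generalized_hurwitz_density Y \<Omega> w \<le> ereal (hurwitz_density \<Omega> w / c)" if c: "0 < c" "c < 1" for c
  proof -
    have "ereal c < (SUP s \<in> Y. ereal (hurwitz_density (ball 0 1) s / hurwitz_density Y s))"
      using c by (simp add: sup one_ereal_def)
    then obtain s where s: "s \<in> Y" "c < hurwitz_density (ball 0 1) s / hurwitz_density Y s"
      by (auto simp: less_SUP_iff)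
    have "hurwitz_density Y s > 0"
      using pos[OF Y(1) s(1) Y(3)] .
    moreover have "hurwitz_density \<Omega> w > 0"
      using pos[OF \<Omega> w assms(2)] .
    \<comment> \<open>Read off from the quotient: it exceeds \<open>c > 0\<close> and its
      denominator is positive.\<close>
    moreover have "hurwitz_density (ball 0 1) s > 0"
      using calculation(1) s(2) c(1) by (smt (verit) divide_nonpos_pos)
    ultimately have "hurwitz_density Y s / hurwitz_density (ball 0 1) s * hurwitz_density \<Omega> w
        \<le> hurwitz_density \<Omega> w / c"
      using s(2) c by (simp add: field_simps)
    then show ?thesis
      using generalized_hurwitz_density_le[OF \<Omega> w assms(2) Y(2) s(1)]
      by (meson ereal_less_eq(3) order_trans)
  qed
  then have "\<forall>\<^sub>F c in at_left 1. generalized_hurwitz_density Y \<Omega> w \<le> ereal (hurwitz_density \<Omega> w / c)"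
    using eventually_at_left_real[of 0 "1::real"] by (auto elim: eventually_mono)
  moreover have "((\<lambda>c. ereal (hurwitz_density \<Omega> w / c)) \<longlongrightarrow> ereal (hurwitz_density \<Omega> w / 1)) (at_left 1)"
    by (intro tendsto_intros) auto
  ultimately show "generalized_hurwitz_density Y \<Omega> w \<le> ereal (hurwitz_density \<Omega> w)"
    using tendsto_lowerbound by (metis div_by_1 trivial_limit_at_left_real)
qed

end
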